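(* Let $f,g$ be polymatroid functions on $V$ and consider the SCSC instance $\min\{f(X): g(X)\ge c\}$ with optimal solution $X^*$. Let $K_g=1+\max\{|X|: g(X)<c\}$. (i) Primal ISSC. Let $X^0=\emptyset$. For $t=0,1,\dots,T-1$ (with $T\ge1$), let $X^{t+1}$ be the output of an SSC algorithm applied to $\min\{m^f_{X^t}(X): g(X)\ge c\}$. Here $m^f_{X^t}$ is either of the modular upper bounds defined below, and the SSC algorithm, for any nonnegative modular cost $w$, returns a set $Y$ with $g(Y)\ge c$ and $w(Y)\le H_g\min\{w(Z): g(Z)\ge c\}$. The algorithm returns the iterate $\hat X\in\{X^1,\dots,X^T\}$ of smallest $f$-value. Then $$f(\hat X)\le \frac{K_gH_g}{1+(K_g-1)(1-\kappa_f)}f(X^* )\le\frac{n}{1+(n-1)(1-\kappa_f)}H_g\,f(X^* ).$$ (ii) Dual ISSC. Let $\epsilon>0$. Run the same iteration, but solve each surrogate problem $\min\{m^f_{X^t}(X): g(X)\ge c\}$ with the $[1+\epsilon,1-e^{-1}]$ bicriterion dual greedy algorithm for SSC. This algorithm returns $Y$ with $g(Y)\ge(1-e^{-1})c$ and $m^f_{X^t}(Y)\le(1+\epsilon)\min\{m^f_{X^t}(Z): g(Z)\ge c\}$. Return the iterate of smallest $f$-value. The returned set $\hat X$ then satisfies $$f(\hat X)\le\frac{(1+\epsilon)K_g}{1+(K_g-1)(1-\kappa_f)}f(X^* )\quad\text{and}\quad g(\hat X)\ge(1-e^{-1})c.$$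
   Context: Let $V=\{1,\dots,n\}$. A polymatroid function is a monotone non-decreasing set function $h:2^V\to\mathbb R$ with $h(\emptyset)=0$ that is submodular, i.e. $h(S)+h(T)\ge h(S\cup T)+h(S\cap T)$ for all $S,T\subseteq V$. Write $h(j\mid S)=h(S\cup\{j\})-h(S)$. Assume $f(\{j\})>0$ and $g(\{j\})>0$ for all $j$. The curvature of $f$ is $\kappa_f=1-\min_{j\in V} f(j\mid V\setminus\{j\})/f(\{j\})$. For $X\subseteq V$ define the modular upper bounds $$m^f_{X,1}(Y)=f(X)-\sum_{j\in X\setminus Y}f(j\mid X\setminus\{j\})+\sum_{j\in Y\setminus X}f(j\mid\emptyset)$$ and $$m^f_{X,2}(Y)=f(X)-\sum_{j\in X\setminus Y}f(j\mid V\setminus\{j\})+\sum_{j\in Y\setminus X}f(j\mid X).$$ Both satisfy $m^f_{X,i}(Y)\ge f(Y)$ for all $Y$ and $m^f_{X,i}(X)=f(X)$. Note that $m^f_{\emptyset}(Y)=\sum_{j\in Y}f(\{j\})$. $H_g$ denotes the approximation factor of the submodular set cover algorithm used with constraint function $g$. For the standard greedy algorithm and integral $g$, $H_g=H(\max_j g(\{j\}))$, where $H(d)=\sum_{i=1}^d 1/i$. *)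

theory Defs
  imports Complex_Main
begin

definition polymatroid :: "'a set \<Rightarrow> ('a set \<Rightarrow> real) \<Rightarrow> bool" where
  "polymatroid V h \<longleftrightarrow>
     h {} = 0 \<and> mono_on (Pow V) h \<and>
     (\<forall>S T. S \<subseteq> V \<longrightarrow> T \<subseteq> V \<longrightarrow> h S + h T \<ge> h (S \<union> T) + h (S \<inter> T))"

definition marginal :: "('a set \<Rightarrow> real) \<Rightarrow> 'a \<Rightarrow> 'a set \<Rightarrow> real" where
  "marginal h j S = h (S \<union> {j}) - h S"

definition curvature :: "'a set \<Rightarrow> ('a set \<Rightarrow> real) \<Rightarrow> real" where
  "curvature V f = 1 - Min ((\<lambda>j. marginal f j (V - {j}) / f {j}) ` V)"

definition modular_ub1 :: "('a set \<Rightarrow> real) \<Rightarrow> 'a set \<Rightarrow> 'a set \<Rightarrow> real" where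
  "modular_ub1 f X Y =
     f X - (\<Sum>j\<in>X - Y. marginal f j (X - {j})) + (\<Sum>j\<in>Y - X. marginal f j {})"

definition modular_ub2 :: "'a set \<Rightarrow> ('a set \<Rightarrow> real) \<Rightarrow> 'a set \<Rightarrow> 'a set \<Rightarrow> real" where
  "modular_ub2 V f X Y =
     f X - (\<Sum>j\<in>X - Y. marginal f j (V - {j})) + (\<Sum>j\<in>Y - X. marginal f j X)"

definition modular_ubs ::
    "'a set \<Rightarrow> ('a set \<Rightarrow> real) \<Rightarrow> 'a set \<Rightarrow> ('a set \<Rightarrow> real) set" where
  "modular_ubs V f X = {modular_ub1 f X, modular_ub2 V f X}"

definition feasible :: "'a set \<Rightarrow> ('a set \<Rightarrow> real) \<Rightarrow> real \<Rightarrow> 'a set set" where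
  "feasible V g c = {X. X \<subseteq> V \<and> g X \<ge> c}"

(* For c \<le> 0 no set has g X < c and the maximum is unspecified; in that case
   the empty set is feasible and the optimal value of the covering problem is 0. *)
definition K_cover :: "'a set \<Rightarrow> ('a set \<Rightarrow> real) \<Rightarrow> real \<Rightarrow> nat" where
  "K_cover V g c = 1 + Max (card ` {X. X \<subseteq> V \<and> g X < c})"

(* Modular functions need not vanish at the empty set: the upper bounds above
   in general have a nonzero constant term. *)
definition nonneg_modular :: "'a set \<Rightarrow> ('a set \<Rightarrow> real) \<Rightarrow> bool" where
  "nonneg_modular V w \<longleftrightarrow>
     (\<forall>S. S \<subseteq> V \<longrightarrow> w S \<ge> 0) \<and>
     (\<forall>S T. S \<subseteq> V \<longrightarrow> T \<subseteq> V \<longrightarrow> w S + w T = w (S \<union> T) + w (S \<inter> T))"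

(* Y is a [\<sigma>, \<rho>] bicriterion solution of min {w Z : g Z \<ge> c}. *)
definition bicriterion_solution ::
    "'a set \<Rightarrow> ('a set \<Rightarrow> real) \<Rightarrow> real \<Rightarrow> real \<Rightarrow> real \<Rightarrow> ('a set \<Rightarrow> real) \<Rightarrow> 'a set \<Rightarrow> bool" where
  "bicriterion_solution V g c \<sigma> \<rho> w Y \<longleftrightarrow>
     Y \<subseteq> V \<and> g Y \<ge> \<rho> * c \<and> w Y \<le> \<sigma> * Min (w ` feasible V g c)"

definition ssc_algorithm ::
    "'a set \<Rightarrow> ('a set \<Rightarrow> real) \<Rightarrow> real \<Rightarrow> real \<Rightarrow> (('a set \<Rightarrow> real) \<Rightarrow> 'a set) \<Rightarrow> bool" where
  "ssc_algorithm V g c H A \<longleftrightarrow>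
     (\<forall>w. nonneg_modular V w \<longrightarrow>
        A w \<in> feasible V g c \<and> w (A w) \<le> H * Min (w ` feasible V g c))"

definition primal_issc_run ::
    "'a set \<Rightarrow> ('a set \<Rightarrow> real) \<Rightarrow> (('a set \<Rightarrow> real) \<Rightarrow> 'a set) \<Rightarrow> nat \<Rightarrow> (nat \<Rightarrow> 'a set) \<Rightarrow> bool" where
  "primal_issc_run V f A T X \<longleftrightarrow>
     X 0 = {} \<and> (\<forall>t<T. \<exists>m\<in>modular_ubs V f (X t). X (Suc t) = A m)"

(* The dual greedy subroutine enters only through its bicriterion guarantee. *)
definition dual_issc_run ::
    "'a set \<Rightarrow> ('a set \<Rightarrow> real) \<Rightarrow> ('a set \<Rightarrow> real) \<Rightarrow> real \<Rightarrow> real \<Rightarrow> nat \<Rightarrow> (nat \<Rightarrow> 'a set) \<Rightarrow> bool" where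
  "dual_issc_run V f g c \<epsilon> T X \<longleftrightarrow>
     X 0 = {} \<and>
     (\<forall>t<T. \<exists>m\<in>modular_ubs V f (X t).
        bicriterion_solution V g c (1 + \<epsilon>) (1 - exp (- 1)) m (X (Suc t)))"

end

theory Submission
  imports Defs
begin

text \<open>
  Only the first iteration matters: at the empty set both upper bounds equal the modular function
  \<open>Y \<mapsto> (\<Sum>j\<in>Y. f {j})\<close>, and the returned iterate is no worse than the first one. Building up a set
  \<open>X\<close> of size \<open>k\<close> starting from an element \<open>i\<close> gives \<open>f X \<ge> f {i} + a * (\<Sum>j\<in>X - {i}. f {j})\<close>, where
  \<open>a\<close> is one minus the curvature, and averaging over \<open>i \<in> X\<close> yields
  \<open>(\<Sum>j\<in>X. f {j}) \<le> k / (1 + (k - 1) * a) * f X\<close>. This is applied to an inclusion-minimal feasible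
  subset of the optimum: it is still optimal by monotonicity, and since removing any of its elements
  makes it infeasible, its size is at most \<open>K_cover\<close>.
\<close>

section \<open>Monotonicity and diminishing marginals of polymatroid functions\<close>

lemma polymatroid_mono:
  assumes "polymatroid V h" "S \<subseteq> T" "T \<subseteq> V"
  shows "h S \<le> h T"
proof -
  have "mono_on (Pow V) h" using assms(1) by (simp add: polymatroid_def)
  from mono_onD[OF this, of S T] show ?thesis using assms(2,3) by auto
qed

lemma polymatroid_nonneg:
  assumes "polymatroid V h" "S \<subseteq> V"
  shows "0 \<le> h S"
  using polymatroid_mono[OF assms(1) empty_subsetI assms(2)] assms(1)
  by (simp add: polymatroid_def)

lemma marginal_nonneg:
  assumes "polymatroid V h" "S \<subseteq> V" "j \<in> V"
  shows "0 \<le> marginal h j S"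
  using polymatroid_mono[OF assms(1), of S "S \<union> {j}"] assms(2,3) by (auto simp: marginal_def)

text \<open>Diminishing returns: apply submodularity to \<open>S \<union> {j}\<close> and
  \<open>T\<close>. Because \<open>j\<close> lies outside \<open>T\<close>, these two sets meet
  exactly in \<open>S\<close>.\<close>

lemma marginal_antimono:
  assumes h: "polymatroid V h" and "S \<subseteq> T" "T \<subseteq> V" "j \<in> V" "j \<notin> T"
  shows "marginal h j T \<le> marginal h j S"
proof -
  have "h (S \<union> {j}) + h T \<ge> h (S \<union> {j} \<union> T) + h ((S \<union> {j}) \<inter> T)"
    using h assms(2-4) unfolding polymatroid_def
    by (metis Un_least empty_subsetI insert_subset order_trans)
  moreover have "S \<union> {j} \<union> T = T \<union> {j}" "(S \<union> {j}) \<inter> T = S"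
    using assms by auto
  ultimately show ?thesis by (simp add: marginal_def)
qed

text \<open>Adding elements one at a time, each contributes at most its marginal at the empty set.
  This is the majorization property of the surrogate at \<open>{}\<close>.\<close>

lemma polymatroid_le_sum_singletons:
  assumes h: "polymatroid V h" and "finite V" "S \<subseteq> V"
  shows "h S \<le> (\<Sum>j\<in>S. h {j})"
proof -
  have "finite S" using assms finite_subset by blast
  then show ?thesis using \<open>S \<subseteq> V\<close>
  proof (induction S rule: finite_induct)
    case empty
    then show ?case using h by (simp add: polymatroid_def)
  next
    case (insert x S)
    then have "marginal h x S \<le> marginal h x {}"
      by (intro marginal_antimono[OF h]) auto
    then show ?case
      using insert h by (simp add: marginal_def polymatroid_def)
  qed
qed

section \<open>Curvature and the sum of singleton values\<close>

lemma curvature_marginal_bound: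
  assumes h: "polymatroid V h" and "finite V" and pos: "\<And>j. j \<in> V \<Longrightarrow> h {j} > 0"
    and "S \<subseteq> V" "j \<in> V" "j \<notin> S"
  shows "(1 - curvature V h) * h {j} \<le> marginal h j S"
proof -
  have "1 - curvature V h \<le> marginal h j (V - {j}) / h {j}"
    unfolding curvature_def using assms by (auto intro!: Min_le)
  then have "(1 - curvature V h) * h {j} \<le> marginal h j (V - {j})"
    using pos[OF \<open>j \<in> V\<close>] by (simp add: field_simps)
  \<comment> \<open>\<open>V - {j}\<close> is the largest set avoiding \<open>j\<close>, so by
    diminishing returns it has the smallest marginal.\<close>
  also have "\<dots> \<le> marginal h j S"
    using assms by (intro marginal_antimono[OF h]) auto
  finally show ?thesis .
qed

text \<open>Submodularity gives the lower bound, since the marginal of \<open>j\<close> at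
  \<open>V - {j}\<close> is at most \<open>h {j}\<close>; monotonicity gives the upper one.
  Nonemptiness of \<open>V\<close> keeps \<open>Min\<close> away from the empty set.\<close>

lemma curvature_bounds:
  assumes h: "polymatroid V h" and "finite V" "V \<noteq> {}" and pos: "\<And>j. j \<in> V \<Longrightarrow> h {j} > 0"
  shows "0 \<le> curvature V h" "curvature V h \<le> 1"
proof -
  obtain j where j: "j \<in> V" using assms by blast
  have "(1 - curvature V h) * h {j} \<le> marginal h j {}"
    by (rule curvature_marginal_bound) (use assms j in auto)
  then have "(1 - curvature V h) * h {j} \<le> 1 * h {j}"
    using h by (simp add: marginal_def polymatroid_def)
  then have "1 - curvature V h \<le> 1"
    using pos[OF j] by (subst (asm) mult_le_cancel_right_pos) auto
  then show "0 \<le> curvature V h" by simp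
  have "0 \<le> marginal h i (V - {i}) / h {i}" if "i \<in> V" for i
    using marginal_nonneg[OF h, of "V - {i}" i] pos[OF that] that by auto
  then show "curvature V h \<le> 1"
    unfolding curvature_def using assms by simp
qed

lemma polymatroid_ge_one_plus_rest:
  assumes h: "polymatroid V h" and "finite V" and pos: "\<And>j. j \<in> V \<Longrightarrow> h {j} > 0"
    and "i \<in> V" "S \<subseteq> V" "i \<notin> S"
  shows "h {i} + (1 - curvature V h) * (\<Sum>j\<in>S. h {j}) \<le> h (insert i S)"
proof -
  have "finite S" using assms finite_subset by blast
  then show ?thesis using \<open>S \<subseteq> V\<close> \<open>i \<notin> S\<close>
  proof (induction S rule: finite_induct)
    case empty
    then show ?case by simp
  next
    case (insert x S)
    then have "(1 - curvature V h) * h {x} \<le> marginal h x (insert i S)"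
      using assms by (intro curvature_marginal_bound[OF h]) auto
    then show ?case
      using insert by (simp add: marginal_def insert_commute algebra_simps)
  qed
qed

text \<open>The product form avoids division, so the empty set needs no special case and positivity
  of the denominator is left to the use site.\<close>

lemma sum_singletons_le_curvature:
  assumes h: "polymatroid V h" and "finite V" and pos: "\<And>j. j \<in> V \<Longrightarrow> h {j} > 0"
    and "S \<subseteq> V"
  shows "(1 + (real (card S) - 1) * (1 - curvature V h)) * (\<Sum>j\<in>S. h {j}) \<le> real (card S) * h S"
proof -
  let ?a = "1 - curvature V h" and ?s = "\<Sum>j\<in>S. h {j}"
  have fin: "finite S" using assms finite_subset by blast
  have "h {i} + ?a * (?s - h {i}) \<le> h S" if "i \<in> S" for i
  proof -
    have "h {i} + ?a * (\<Sum>j\<in>S - {i}. h {j}) \<le> h (insert i (S - {i}))"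
      using assms that by (intro polymatroid_ge_one_plus_rest[OF h]) auto
    then show ?thesis
      using that fin by (simp add: sum_diff1 insert_absorb)
  qed
  then have "(\<Sum>i\<in>S. h {i} + ?a * (?s - h {i})) \<le> (\<Sum>i\<in>S. h S)"
    by (rule sum_mono)
  \<comment> \<open>Over all choices of the starting element, each singleton is counted once in full
    and \<open>card S - 1\<close> times with weight \<open>?a\<close>.\<close>
  moreover have "(\<Sum>i\<in>S. h {i} + ?a * (?s - h {i})) = ?s + ?a * (real (card S) * ?s - ?s)"
    by (simp add: sum.distrib sum_subtractf flip: sum_distrib_left)
  ultimately show ?thesis by (simp add: algebra_simps)
qed

text \<open>After cross-multiplication the difference of the two sides is
  \<open>(y - x) * (1 - a)\<close>. Used to pass from the size of a minimal optimal set to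
  \<open>K_cover\<close>, and from there to \<open>n\<close>.\<close>

lemma curvature_ratio_mono:
  fixes a x y :: real
  assumes "0 \<le> a" "a \<le> 1" "1 \<le> x" "x \<le> y"
  shows "x / (1 + (x - 1) * a) \<le> y / (1 + (y - 1) * a)"
proof -
  have "0 < 1 + (x - 1) * a" "0 < 1 + (y - 1) * a"
    using assms by (simp_all add: add_pos_nonneg)
  moreover have "x * (1 + (y - 1) * a) \<le> y * (1 + (x - 1) * a)"
    using mult_right_mono[of x y "1 - a"] assms by (simp add: algebra_simps)
  ultimately show ?thesis by (simp add: frac_le_eq divide_simps mult.commute)
qed

section \<open>The surrogate problem at the empty set\<close>

lemma modular_ubs_empty:
  assumes "f {} = 0"
  shows "modular_ubs V f {} = {\<lambda>Y. \<Sum>j\<in>Y. f {j}}"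
  \<comment> \<open>At \<open>X = {}\<close> the subtracted sums are empty and both remaining
    marginals are taken at \<open>{}\<close>, so the two bounds coincide.\<close>
  using assms by (simp add: modular_ubs_def modular_ub1_def modular_ub2_def marginal_def fun_eq_iff)

lemma nonneg_modular_sum:
  fixes w :: "'a \<Rightarrow> real"
  assumes "finite V" "\<And>j. j \<in> V \<Longrightarrow> w j \<ge> 0"
  shows "nonneg_modular V (\<lambda>Y. \<Sum>j\<in>Y. w j)"
  unfolding nonneg_modular_def
proof (intro conjI allI impI)
  fix S assume "S \<subseteq> V"
  then show "0 \<le> (\<Sum>j\<in>S. w j)" using assms by (intro sum_nonneg) auto
next
  fix S T assume "S \<subseteq> V" "T \<subseteq> V"
  then have "finite S" "finite T" using \<open>finite V\<close> finite_subset by blast+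
  then show "(\<Sum>j\<in>S. w j) + (\<Sum>j\<in>T. w j) = (\<Sum>j\<in>S \<union> T. w j) + (\<Sum>j\<in>S \<inter> T. w j)"
    by (simp add: sum.union_inter)
qed

text \<open>Test the algorithm on the constant cost 1, which is modular in the sense that allows a
  constant term: every feasible set then costs 1. The consequence \<open>0 \<le> H\<close> permits
  multiplying inequalities by \<open>H\<close>.\<close>

lemma ssc_algorithm_factor_ge_1:
  assumes "finite V" "ssc_algorithm V g c H A"
  shows "1 \<le> H"
proof -
  let ?w = "\<lambda>_::'a set. 1 :: real"
  have "nonneg_modular V ?w" by (simp add: nonneg_modular_def)
  then have A: "A ?w \<in> feasible V g c" "1 \<le> H * Min (?w ` feasible V g c)"
    using assms(2) unfolding ssc_algorithm_def by blast+
  then have "?w ` feasible V g c = {1}" by auto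
  then show ?thesis using A by simp
qed

section \<open>Feasible sets and the size of \<open>K_cover\<close>\<close>

lemma finite_feasible: "finite V \<Longrightarrow> finite (feasible V g c)"
  by (rule finite_subset[of _ "Pow V"]) (auto simp: feasible_def)

lemma K_cover_ge:
  assumes "finite V" "S \<subseteq> V" "g S < c"
  shows "Suc (card S) \<le> K_cover V g c"
proof -
  have "finite {X. X \<subseteq> V \<and> g X < c}" using \<open>finite V\<close> by simp
  then have "card S \<le> Max (card ` {X. X \<subseteq> V \<and> g X < c})"
    using assms(2,3) by (intro Max_ge) blast+
  then show ?thesis by (simp add: K_cover_def)
qed

text \<open>By monotonicity \<open>V\<close> itself is feasible, so infeasible sets are proper
  subsets. Positivity of \<open>c\<close> makes \<open>{}\<close> infeasible, so the maximum ranges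
  over a nonempty family.\<close>

lemma K_cover_le_card:
  assumes g: "polymatroid V g" and "finite V" "feasible V g c \<noteq> {}" "0 < c"
  shows "K_cover V g c \<le> card V"
proof -
  obtain Z where "Z \<subseteq> V" "c \<le> g Z" using assms(3) by (auto simp: feasible_def)
  then have "c \<le> g V" using polymatroid_mono[OF g, of Z V] by simp
  then have "card S < card V" if "S \<subseteq> V" "g S < c" for S
    using that by (intro psubset_card_mono[OF \<open>finite V\<close>]) auto
  moreover have "{} \<in> {X. X \<subseteq> V \<and> g X < c}"
    using g \<open>0 < c\<close> by (simp add: polymatroid_def)
  moreover have "finite {X. X \<subseteq> V \<and> g X < c}" using \<open>finite V\<close> by simp
  ultimately have "Max (card ` {X. X \<subseteq> V \<and> g X < c}) < card V"
    by (subst Max_less_iff) blast+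
  then show ?thesis by (simp add: K_cover_def)
qed

text \<open>Settles \<open>c \<le> 0\<close>, where \<open>K_cover\<close> takes the maximum of an
  empty family: the factor 0 cancels the ratio, whatever its value.\<close>

lemma optimal_value_eq_0:
  assumes f: "polymatroid V f" and g: "polymatroid V g" and "c \<le> 0"
    and opt: "is_arg_min f (\<lambda>X. X \<in> feasible V g c) Xopt"
  shows "f Xopt = 0"
proof -
  have "{} \<in> feasible V g c" using g \<open>c \<le> 0\<close> by (simp add: feasible_def polymatroid_def)
  then have "f Xopt \<le> f {}" using opt by (auto simp: is_arg_min_def not_less)
  moreover have "0 \<le> f Xopt"
    using opt polymatroid_nonneg[OF f] by (auto simp: is_arg_min_def feasible_def)
  ultimately show ?thesis using f by (simp add: polymatroid_def)
qed

section \<open>The approximation factor via a minimal optimal set\<close>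

lemma small_optimal_solution:
  assumes f: "polymatroid V f" and "finite V" "0 < c" and g: "polymatroid V g"
    and opt: "is_arg_min f (\<lambda>X. X \<in> feasible V g c) Xopt"
  obtains Z where "Z \<in> feasible V g c" "f Z = f Xopt" "Z \<noteq> {}" "card Z \<le> K_cover V g c"
proof -
  have X: "Xopt \<in> feasible V g c" using opt by (simp add: is_arg_min_def)
  obtain Z where Z: "Z \<in> feasible V g c" "Z \<subseteq> Xopt"
    and Zmin: "\<And>W. W \<in> feasible V g c \<Longrightarrow> W \<subseteq> Z \<Longrightarrow> Z = W"
    using finite_has_minimal2[OF finite_feasible[OF \<open>finite V\<close>] X] by auto
  have ZV: "Z \<subseteq> V" "c \<le> g Z" using Z by (auto simp: feasible_def)
  have "f Z \<le> f Xopt"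
    using Z X by (intro polymatroid_mono[OF f]) (auto simp: feasible_def)
  moreover have "f Xopt \<le> f Z"
    using opt Z by (simp add: is_arg_min_def not_less[symmetric])
  ultimately have fZ: "f Z = f Xopt" by simp
  have ne: "Z \<noteq> {}" using ZV g \<open>0 < c\<close> by (auto simp: polymatroid_def)
  then obtain j where j: "j \<in> Z" by blast
  have "Z - {j} \<notin> feasible V g c" using Zmin[of "Z - {j}"] j by blast
  then have "g (Z - {j}) < c" using Z ZV by (auto simp: feasible_def)
  \<comment> \<open>\<open>Z - {j}\<close> is one of the infeasible sets in the maximum; the added 1
    in \<open>K_cover\<close> pays for \<open>j\<close>.\<close>
  then have "Suc (card (Z - {j})) \<le> K_cover V g c"
    using ZV by (intro K_cover_ge \<open>finite V\<close>) auto
  then have "card Z \<le> K_cover V g c"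
    using j card_Suc_Diff1[OF finite_subset[OF ZV(1) \<open>finite V\<close>] j] by simp
  then show thesis using that Z fZ ne by blast
qed

text \<open>Common core of both algorithms, with \<open>\<sigma>\<close> being \<open>H\<close> or
  \<open>1 + \<epsilon>\<close>. Only \<open>Y \<subseteq> V\<close> is asked of the output, since a
  dual iterate may fall short of \<open>c\<close>.\<close>

lemma first_iterate_bound:
  assumes f: "polymatroid V f" and g: "polymatroid V g" and fin: "finite V"
    and pos: "\<And>j. j \<in> V \<Longrightarrow> f {j} > 0"
    and opt: "is_arg_min f (\<lambda>X. X \<in> feasible V g c) Xopt"
    and Y: "Y \<subseteq> V" and "0 \<le> \<sigma>"
    and le: "(\<Sum>j\<in>Y. f {j}) \<le> \<sigma> * Min ((\<lambda>Z. \<Sum>j\<in>Z. f {j}) ` feasible V g c)"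
  shows "f Y \<le> \<sigma> * real (K_cover V g c)
                 / (1 + (real (K_cover V g c) - 1) * (1 - curvature V f)) * f Xopt"
proof -
  have bound: "f Y \<le> \<sigma> * (\<Sum>j\<in>Z. f {j})" if "Z \<in> feasible V g c" for Z
  proof -
    have "Min ((\<lambda>Z. \<Sum>j\<in>Z. f {j}) ` feasible V g c) \<le> (\<Sum>j\<in>Z. f {j})"
      using that finite_feasible[OF fin] by (intro Min_le) auto
    then have "\<sigma> * Min ((\<lambda>Z. \<Sum>j\<in>Z. f {j}) ` feasible V g c) \<le> \<sigma> * (\<Sum>j\<in>Z. f {j})"
      using \<open>0 \<le> \<sigma>\<close> by (rule mult_left_mono)
    then show ?thesis using polymatroid_le_sum_singletons[OF f fin Y] le by linarith
  qed
  show ?thesis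
  proof (cases "c \<le> 0")
    case True
    \<comment> \<open>Here \<open>{}\<close> is feasible at surrogate cost 0.\<close>
    then have "f Y \<le> 0"
      using bound[of "{}"] g by (simp add: feasible_def polymatroid_def)
    then show ?thesis using optimal_value_eq_0[OF f g True opt] by simp
  next
    case False
    let ?a = "1 - curvature V f" and ?K = "real (K_cover V g c)"
    obtain Z where Z: "Z \<in> feasible V g c" "f Z = f Xopt" "Z \<noteq> {}" "card Z \<le> K_cover V g c"
      using small_optimal_solution[OF f fin _ g opt] False by auto
    have ZV: "Z \<subseteq> V" using Z by (simp add: feasible_def)
    let ?k = "real (card Z)"
    have k: "1 \<le> ?k"
      using Z(3) finite_subset[OF ZV fin] by (simp add: Suc_le_eq card_gt_0_iff)
    have "V \<noteq> {}" using Z(3) ZV by blast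
    then have a: "0 \<le> ?a" "?a \<le> 1"
      using curvature_bounds[OF f fin _ pos] by simp_all
    \<comment> \<open>Nonemptiness of \<open>Z\<close> gives \<open>1 \<le> ?k\<close>, so the
      denominator is at least 1 even for curvature 1.\<close>
    have "0 < 1 + (?k - 1) * ?a" using a k by (simp add: add_pos_nonneg)
    then have "(\<Sum>j\<in>Z. f {j}) \<le> ?k / (1 + (?k - 1) * ?a) * f Z"
      using sum_singletons_le_curvature[OF f fin pos ZV] by (simp add: pos_le_divide_eq mult.commute)
    also have "\<dots> \<le> ?K / (1 + (?K - 1) * ?a) * f Z"
      using a k Z(4) polymatroid_nonneg[OF f ZV]
      by (intro mult_right_mono curvature_ratio_mono) auto
    finally have "\<sigma> * (\<Sum>j\<in>Z. f {j}) \<le> \<sigma> * (?K / (1 + (?K - 1) * ?a) * f Z)"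
      using \<open>0 \<le> \<sigma>\<close> by (rule mult_left_mono)
    then show ?thesis using bound[OF Z(1)] Z(2) by simp
  qed
qed

lemma K_cover_ratio_le:
  assumes f: "polymatroid V f" and g: "polymatroid V g" and fin: "finite V"
    and pos: "\<And>j. j \<in> V \<Longrightarrow> f {j} > 0"
    and opt: "is_arg_min f (\<lambda>X. X \<in> feasible V g c) Xopt"
  shows "real (K_cover V g c) / (1 + (real (K_cover V g c) - 1) * (1 - curvature V f)) * f Xopt
       \<le> real (card V) / (1 + (real (card V) - 1) * (1 - curvature V f)) * f Xopt"
proof (cases "c \<le> 0")
  case True
  then show ?thesis using optimal_value_eq_0[OF f g True opt] by simp
next
  case False
  have X: "Xopt \<in> feasible V g c" using opt by (simp add: is_arg_min_def)
  then have ne: "feasible V g c \<noteq> {}" by blast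
  have "K_cover V g c \<le> card V" using K_cover_le_card[OF g fin ne] False by simp
  moreover have "1 \<le> K_cover V g c" by (simp add: K_cover_def)
  moreover have "0 \<le> f Xopt" using X polymatroid_nonneg[OF f] by (simp add: feasible_def)
  moreover have "V \<noteq> {}" using X False g by (auto simp: feasible_def polymatroid_def)
  then have "0 \<le> curvature V f" "curvature V f \<le> 1"
    using curvature_bounds[OF f fin _ pos] by simp_all
  ultimately show ?thesis
    by (intro mult_right_mono curvature_ratio_mono) simp_all
qed

theorem theorem3:
  fixes n :: nat and V :: "nat set" and f g :: "nat set \<Rightarrow> real" and c :: real
    and Xopt :: "nat set"
  assumes V: "V = {1..n}"
    and f: "polymatroid V f" and g: "polymatroid V g"
    and f_pos: "\<And>j. j \<in> V \<Longrightarrow> f {j} > 0" and g_pos: "\<And>j. j \<in> V \<Longrightarrow> g {j} > 0"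
    and opt: "is_arg_min f (\<lambda>X. X \<in> feasible V g c) Xopt"
  shows
    "(\<forall>(H::real) A (T::nat) X Xhat.
        T \<ge> 1 \<longrightarrow> ssc_algorithm V g c H A \<longrightarrow> primal_issc_run V f A T X \<longrightarrow>
        is_arg_min f (\<lambda>Y. Y \<in> X ` {1..T}) Xhat \<longrightarrow>
          f Xhat \<le> real (K_cover V g c) * H
                     / (1 + (real (K_cover V g c) - 1) * (1 - curvature V f)) * f Xopt \<and>
          real (K_cover V g c) * H
                     / (1 + (real (K_cover V g c) - 1) * (1 - curvature V f)) * f Xopt
            \<le> real n / (1 + (real n - 1) * (1 - curvature V f)) * H * f Xopt)
     \<and>
     (\<forall>(\<epsilon>::real) (T::nat) X Xhat.
        \<epsilon> > 0 \<longrightarrow> T \<ge> 1 \<longrightarrow> dual_issc_run V f g c \<epsilon> T X \<longrightarrow>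
        is_arg_min f (\<lambda>Y. Y \<in> X ` {1..T}) Xhat \<longrightarrow>
          f Xhat \<le> (1 + \<epsilon>) * real (K_cover V g c)
                     / (1 + (real (K_cover V g c) - 1) * (1 - curvature V f)) * f Xopt \<and>
          g Xhat \<ge> (1 - exp (- 1)) * c)"
proof (intro conjI allI impI)
  have fin: "finite V" and card: "card V = n" using V by auto
  have f0: "f {} = 0" using f by (simp add: polymatroid_def)
  have first: "f Xhat \<le> f (X 1)"
    if "1 \<le> T" "is_arg_min f (\<lambda>Y. Y \<in> X ` {1..T}) Xhat" for T :: nat and X Xhat
    using that by (simp add: is_arg_min_def not_less)
  {
    fix H A T X Xhat
    assume T: "1 \<le> T" and A: "ssc_algorithm V g c H A" and run: "primal_issc_run V f A T X"
      and hat: "is_arg_min f (\<lambda>Y. Y \<in> X ` {1..T}) Xhat"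
    have H: "0 \<le> H" using ssc_algorithm_factor_ge_1[OF fin A] by simp
    \<comment> \<open>Instantiate the run at \<open>t = 0\<close>, available because
      \<open>1 \<le> T\<close>; the choice of upper bound disappears there.\<close>
    have X1: "X 1 = A (\<lambda>Y. \<Sum>j\<in>Y. f {j})"
      using run T by (auto simp: primal_issc_run_def modular_ubs_empty[where f = f, OF f0] dest!: spec[of _ 0])
    have "nonneg_modular V (\<lambda>Y. \<Sum>j\<in>Y. f {j})"
      using f_pos by (intro nonneg_modular_sum fin) (simp add: less_imp_le)
    then have A1: "A (\<lambda>Y. \<Sum>j\<in>Y. f {j}) \<in> feasible V g c"
      "(\<Sum>j\<in>A (\<lambda>Y. \<Sum>j\<in>Y. f {j}). f {j}) \<le> H * Min ((\<lambda>Z. \<Sum>j\<in>Z. f {j}) ` feasible V g c)"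
      using A unfolding ssc_algorithm_def by blast+
    have "f (X 1) \<le> H * real (K_cover V g c)
                 / (1 + (real (K_cover V g c) - 1) * (1 - curvature V f)) * f Xopt"
      using A1 unfolding X1
      by (intro first_iterate_bound[OF f g fin f_pos opt _ H]) (auto simp: feasible_def)
    then show "f Xhat \<le> real (K_cover V g c) * H
                 / (1 + (real (K_cover V g c) - 1) * (1 - curvature V f)) * f Xopt"
      using first[OF T hat] by (simp add: mult.commute)
    show "real (K_cover V g c) * H
                 / (1 + (real (K_cover V g c) - 1) * (1 - curvature V f)) * f Xopt
            \<le> real n / (1 + (real n - 1) * (1 - curvature V f)) * H * f Xopt"
      using mult_left_mono[OF K_cover_ratio_le[OF f g fin f_pos opt] H]
      unfolding card by (simp add: ac_simps)
  next
    fix \<epsilon> :: real and T :: nat and X Xhat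
    assume eps: "0 < \<epsilon>" and T: "1 \<le> T" and run: "dual_issc_run V f g c \<epsilon> T X"
      and hat: "is_arg_min f (\<lambda>Y. Y \<in> X ` {1..T}) Xhat"
    have "bicriterion_solution V g c (1 + \<epsilon>) (1 - exp (- 1)) (\<lambda>Y. \<Sum>j\<in>Y. f {j}) (X 1)"
      using run T by (auto simp: dual_issc_run_def modular_ubs_empty[where f = f, OF f0] dest!: spec[of _ 0])
    then have "f (X 1) \<le> (1 + \<epsilon>) * real (K_cover V g c)
                 / (1 + (real (K_cover V g c) - 1) * (1 - curvature V f)) * f Xopt"
      using eps by (intro first_iterate_bound[OF f g fin f_pos opt])
        (auto simp: bicriterion_solution_def)
    then show "f Xhat \<le> (1 + \<epsilon>) * real (K_cover V g c)
                 / (1 + (real (K_cover V g c) - 1) * (1 - curvature V f)) * f Xopt"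
      using first[OF T hat] by simp
    \<comment> \<open>Unlike the cost bound, coverage must be read off at the returned iterate
      itself. Its index starts at 1, so it is an output of the subroutine and never
      \<open>X 0\<close>.\<close>
    obtain t where t: "t < T" "Xhat = X (Suc t)"
      using hat by (auto simp: is_arg_min_def Suc_le_eq gr0_conv_Suc)
    then show "(1 - exp (- 1)) * c \<le> g Xhat"
      using run unfolding dual_issc_run_def bicriterion_solution_def by blast
  }
qed

end
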